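(* Let $n$ be a positive integer, let $S=\mathscr{IO}_{\infty}(\mathbb{Z}^n_{\mathrm{lex}})$, and let $\mathfrak{C}$ be a congruence on the semigroup $S$. Let $\Delta_S$ denote the identity congruence on $S$. Then the following statements hold: (i) If $\Delta_S\subseteq \mathfrak{C}\subseteq\sigma_{[i_m]}$ for some $i_m\in\{1,\ldots,n\}$, then either $\mathfrak{C}=\Delta_S$ or $\mathfrak{C}=\sigma_{[i_m]}$. (ii) For any subset $\{i_1,\ldots,i_m,i_{m+1}\}\subseteq\{1,\ldots,n\}$ of distinct indices ($m\geq 1$), if $\sigma_{[i_1,\ldots,i_m]}\subseteq \mathfrak{C}\subseteq\sigma_{[i_1,\ldots,i_m,i_{m+1}]}$, then either $\mathfrak{C}=\sigma_{[i_1,\ldots,i_m]}$ or $\mathfrak{C}=\sigma_{[i_1,\ldots,i_m,i_{m+1}]}$.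
   Context: Partial maps are written on the right and composed left to right: $x(\alpha\beta)=(x\alpha)\beta$, defined when $x\in\operatorname{dom}\alpha$ and $x\alpha\in\operatorname{dom}\beta$. A partial map $\alpha$ of a partially ordered set is monotone if $x\leqslant y$ implies $(x)\alpha\leqslant (y)\alpha$ for $x,y\in\operatorname{dom}\alpha$. Let $L_n=\{1,\ldots,n\}$ and $\mathbb{Z}$ carry their usual linear orders, and let $L_n\times_{\mathrm{lex}}\mathbb{Z}$ be $L_n\times\mathbb{Z}$ with the lexicographic order: $(i,m)\leqslant(j,k)$ iff $i<j$, or $i=j$ and $m\leq k$. $\mathscr{IO}_{\infty}(\mathbb{Z}^n_{\mathrm{lex}})$ is the semigroup (in fact an inverse monoid) under composition of all injective monotone partial selfmaps of $L_n\times_{\mathrm{lex}}\mathbb{Z}$ whose domain and image are both cofinite (have finite complement). $\mathscr{IO}_{\infty}(\mathbb{Z})$ is the analogous monoid of injective monotone partial selfmaps of $\mathbb{Z}$ with cofinite domains and images. It is known that $\mathscr{IO}_{\infty}(\mathbb{Z}^n_{\mathrm{lex}})$ is isomorphic to the direct power $(\mathscr{IO}_{\infty}(\mathbb{Z}))^n$ (by restricting a map to each copy $\{i\}\times\mathbb{Z}$), and elements are identified with tuples $\alpha=(\alpha_1,\ldots,\alpha_n)$, $\alpha_i\in\mathscr{IO}_{\infty}(\mathbb{Z})$. Let $\mathbb{I}_j$ be the identity of the $j$-th factor, and $\alpha_i^\circ=(\mathbb{I}_1,\ldots,\mathbb{I}_{i-1},\alpha_i,\mathbb{I}_{i+1},\ldots,\mathbb{I}_n)$.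 For $i\in\{1,\ldots,n\}$ the relation $\sigma_{[i]}$ on $\mathscr{IO}_{\infty}(\mathbb{Z}^n_{\mathrm{lex}})$ is defined by: $\alpha\,\sigma_{[i]}\,\beta$ iff there exists an idempotent $\varepsilon=(\varepsilon_1,\ldots,\varepsilon_n)\in\mathscr{IO}_{\infty}(\mathbb{Z}^n_{\mathrm{lex}})$ such that $\alpha\varepsilon_i^\circ=\beta\varepsilon_i^\circ$. For distinct $i_1,\ldots,i_k\in\{1,\ldots,n\}$ put $\sigma_{[i_1,\ldots,i_k]}=\sigma_{[i_1]}\circ\cdots\circ\sigma_{[i_k]}$ (composition of relations). It is known that $\sigma_{[i]}$ and $\sigma_{[i_1,\ldots,i_k]}$ are congruences. *)

theory Defs
  imports Main "HOL-Library.Product_Lexorder"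
begin

definition IO_inf :: "'a::order set \<Rightarrow> ('a \<rightharpoonup> 'a) set" where
  "IO_inf X = {\<alpha>. dom \<alpha> \<subseteq> X \<and> ran \<alpha> \<subseteq> X \<and> finite (X - dom \<alpha>) \<and> finite (X - ran \<alpha>) \<and>
                 inj_on \<alpha> (dom \<alpha>) \<and> mono_on (dom \<alpha>) (\<lambda>x. the (\<alpha> x))}"

text \<open>Maps act on the right, so a product is read from left to right.\<close>

definition pmult :: "('a \<rightharpoonup> 'a) \<Rightarrow> ('a \<rightharpoonup> 'a) \<Rightarrow> ('a \<rightharpoonup> 'a)" (infixl "\<cdot>" 70) where
  "\<alpha> \<cdot> \<beta> = \<beta> \<circ>\<^sub>m \<alpha>"

text \<open>The order on \<^typ>\<open>nat \<times> int\<close> is the lexicographic one from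
  \<^theory>\<open>HOL-Library.Product_Lexorder\<close>.\<close>

definition IO_lex :: "nat \<Rightarrow> (nat \<times> int \<rightharpoonup> nat \<times> int) set" where
  "IO_lex n = IO_inf ({1..n} \<times> UNIV)"

text \<open>The identification of \<^term>\<open>IO_lex n\<close> with the \<open>n\<close>-th direct power of
  \<^term>\<open>IO_inf (UNIV :: int set)\<close>. Every member of \<^term>\<open>IO_lex n\<close> maps each copy
  \<open>{i} \<times> \<int>\<close> into itself, so \<open>component\<close> loses nothing by dropping the first coordinate of
  the value.\<close>

definition component :: "nat \<Rightarrow> (nat \<times> int \<rightharpoonup> nat \<times> int) \<Rightarrow> (int \<rightharpoonup> int)" where
  "component i \<alpha> = (\<lambda>k. map_option snd (\<alpha> (i, k)))"

definition tuple :: "nat \<Rightarrow> (nat \<Rightarrow> (int \<rightharpoonup> int)) \<Rightarrow> (nat \<times> int \<rightharpoonup> nat \<times> int)" where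
  "tuple n a = (\<lambda>(j, k). if j \<in> {1..n} then map_option (Pair j) (a j k) else None)"

text \<open>\<open>circ n i \<alpha>\<close> is \<open>(I, \<dots>, I, \<alpha>\<^sub>i, I, \<dots>, I)\<close> with \<open>\<alpha>\<^sub>i\<close> in position \<open>i\<close>;
  \<^term>\<open>Some\<close> is the identity map.\<close>

definition circ :: "nat \<Rightarrow> nat \<Rightarrow> (nat \<times> int \<rightharpoonup> nat \<times> int) \<Rightarrow> (nat \<times> int \<rightharpoonup> nat \<times> int)" where
  "circ n i \<alpha> = tuple n (\<lambda>j. if j = i then component i \<alpha> else Some)"

definition sigma :: "nat \<Rightarrow> nat \<Rightarrow> ((nat \<times> int \<rightharpoonup> nat \<times> int) \<times> (nat \<times> int \<rightharpoonup> nat \<times> int)) set" where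
  "sigma n i = {(\<alpha>, \<beta>). \<alpha> \<in> IO_lex n \<and> \<beta> \<in> IO_lex n \<and>
     (\<exists>\<epsilon>\<in>IO_lex n. \<epsilon> \<cdot> \<epsilon> = \<epsilon> \<and> \<alpha> \<cdot> circ n i \<epsilon> = \<beta> \<cdot> circ n i \<epsilon>)}"

text \<open>The value at the empty list is a convention; \<open>sigma_list\<close> is meant for nonempty lists of
  distinct indices.\<close>

fun sigma_list ::
  "nat \<Rightarrow> nat list \<Rightarrow> ((nat \<times> int \<rightharpoonup> nat \<times> int) \<times> (nat \<times> int \<rightharpoonup> nat \<times> int)) set" where
  "sigma_list n [] = Id_on (IO_lex n)"
| "sigma_list n [i] = sigma n i"
| "sigma_list n (i # j # js) = sigma n i O sigma_list n (j # js)"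

definition semigroup_congruence :: "('a \<rightharpoonup> 'a) set \<Rightarrow> (('a \<rightharpoonup> 'a) \<times> ('a \<rightharpoonup> 'a)) set \<Rightarrow> bool" where
  "semigroup_congruence S C \<longleftrightarrow> equiv S C \<and>
     (\<forall>(\<alpha>, \<beta>)\<in>C. \<forall>\<gamma>\<in>S. (\<gamma> \<cdot> \<alpha>, \<gamma> \<cdot> \<beta>) \<in> C \<and> (\<alpha> \<cdot> \<gamma>, \<beta> \<cdot> \<gamma>) \<in> C)"

end

theory Submission
  imports Defs
begin

text \<open>
  Write \<open>X\<close> for the set of all points \<open>(i, k)\<close>, and call \<open>{i} \<times> \<int>\<close> the \<open>i\<close>-th layer. The theorem
  rests on two facts.

  First, pairs in \<open>\<sigma>\<^sub>i\<close> agree outside the \<open>i\<close>-th layer and differ at finitely many points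
  (\<open>sigma_agree_off_layer\<close>, \<open>sigma_finite_difference\<close>). The former needs that every member of the
  monoid maps each layer into itself (\<open>layer_preserved\<close>): an infinite part of one layer cannot be
  injected into a bounded interval of another, so by induction no map sends a point to a lower layer,
  and neither does its inverse.

  Second, a congruence \<open>C\<close> containing a pair \<open>(\<alpha>, \<beta>)\<close> that differs at finitely many points, one of
  them in the \<open>j\<close>-th layer, contains all of \<open>\<sigma>\<^sub>j\<close> (\<open>sigma_subset_congruence\<close>). One may assume that
  \<open>\<alpha>\<close> is defined at the point \<open>p\<close> in question and \<open>\<beta>\<close> is not. A left factor that spreads \<open>X\<close> apart,
  so that its image avoids every other point where \<open>\<alpha>\<close> is undefined or differs from \<open>\<beta>\<close>, makes
  \<open>\<alpha>\<close> total and leaves \<open>\<beta>\<close> undefined at only one point, which can be prescribed within the layer.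
  Cancelling \<open>\<alpha>\<close> by its inverse on the right relates the identity to the identity with that point
  removed. Products then remove any finite part of the \<open>j\<close>-th layer, which is what \<open>\<sigma>\<^sub>j\<close> needs.

  Now let \<open>C\<close> lie between \<open>\<sigma>\<^sub>K\<close> and \<open>\<sigma>\<^sub>K \<circ> \<sigma>\<^sub>j\<close>, where \<open>j \<notin> K\<close> and \<open>K\<close> may be empty. If some pair in
  \<open>C\<close> differs in the \<open>j\<close>-th layer, then \<open>\<sigma>\<^sub>j \<subseteq> C\<close>, and transitivity gives \<open>\<sigma>\<^sub>K \<circ> \<sigma>\<^sub>j \<subseteq> C\<close>. Otherwise
  factor \<open>(\<alpha>, \<beta>) \<in> C\<close> through \<open>\<gamma>\<close> with \<open>\<alpha> \<sigma>\<^sub>K \<gamma> \<sigma>\<^sub>j \<beta>\<close>; both \<open>\<gamma>\<close> and \<open>\<beta>\<close> agree with \<open>\<alpha>\<close> in the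
  \<open>j\<close>-th layer, so \<open>\<gamma> = \<beta>\<close> and \<open>(\<alpha>, \<beta>) \<in> \<sigma>\<^sub>K\<close>.
\<close>

section \<open>Inverses and partial identities\<close>

abbreviation layers :: "nat \<Rightarrow> (nat \<times> int) set" where
  "layers n \<equiv> {1..n} \<times> UNIV"

lemma pmult_eq_Some_iff:
  "(\<alpha> \<cdot> \<beta>) x = Some z \<longleftrightarrow> (\<exists>y. \<alpha> x = Some y \<and> \<beta> y = Some z)"
  by (simp add: pmult_def map_comp_Some_iff)

lemma pmult_apply: "(\<alpha> \<cdot> \<beta>) x = (case \<alpha> x of None \<Rightarrow> None | Some y \<Rightarrow> \<beta> y)"
  by (simp add: pmult_def map_comp_def)

lemma IO_inf_inj: "\<lbrakk>\<alpha> \<in> IO_inf X; \<alpha> x = Some z; \<alpha> y = Some z\<rbrakk> \<Longrightarrow> x = y"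
  unfolding IO_inf_def by (force simp: inj_on_def dom_def)

lemma IO_inf_carrier: "\<lbrakk>\<alpha> \<in> IO_inf X; \<alpha> x = Some y\<rbrakk> \<Longrightarrow> x \<in> X \<and> y \<in> X"
  unfolding IO_inf_def by (auto simp: dom_def ran_def)

lemma IO_inf_mono:
  "\<lbrakk>\<alpha> \<in> IO_inf X; x \<le> y; \<alpha> x = Some x'; \<alpha> y = Some y'\<rbrakk> \<Longrightarrow> x' \<le> y'"
  unfolding IO_inf_def by (fastforce simp: mono_on_def dom_def)

definition pinv :: "('a \<rightharpoonup> 'a) \<Rightarrow> ('a \<rightharpoonup> 'a)" where
  "pinv \<alpha> = (\<lambda>y. if y \<in> ran \<alpha> then Some (SOME x. \<alpha> x = Some y) else None)"

lemma pinv_eq_Some_iff: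
  assumes "\<alpha> \<in> IO_inf X"
  shows "pinv \<alpha> y = Some x \<longleftrightarrow> \<alpha> x = Some y"
proof
  assume "pinv \<alpha> y = Some x"
  then show "\<alpha> x = Some y"
    unfolding pinv_def by (auto simp: ran_def split: if_splits intro: someI)
next
  assume x: "\<alpha> x = Some y"
  then have "(SOME x. \<alpha> x = Some y) = x"
    using IO_inf_inj[OF assms] by blast
  with x show "pinv \<alpha> y = Some x"
    unfolding pinv_def by (auto simp: ran_def)
qed

text \<open>On a linear order an injective monotone map also reflects the order, so its inverse is monotone.\<close>

lemma pinv_in_IO_inf:
  fixes X :: "'a::linorder set"
  assumes "\<alpha> \<in> IO_inf X"
  shows "pinv \<alpha> \<in> IO_inf X"
proof -
  note iff = pinv_eq_Some_iff[OF assms]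
  have d: "dom (pinv \<alpha>) = ran \<alpha>" and r: "ran (pinv \<alpha>) = dom \<alpha>"
    by (auto simp: dom_def ran_def iff)
  have "inj_on (pinv \<alpha>) (dom (pinv \<alpha>))"
    by (rule inj_onI) (metis domD iff option.inject)
  moreover have "mono_on (dom (pinv \<alpha>)) (\<lambda>x. the (pinv \<alpha> x))"
  proof (rule mono_onI)
    fix x' y' assume "x' \<in> dom (pinv \<alpha>)" "y' \<in> dom (pinv \<alpha>)" and le: "x' \<le> y'"
    then obtain x y where xy: "pinv \<alpha> x' = Some x" "pinv \<alpha> y' = Some y" by auto
    have "x \<le> y"
    proof (rule ccontr)
      assume "\<not> x \<le> y"
      then have "y' \<le> x'" using IO_inf_mono[OF assms, of y x] xy iff by auto
      with le xy \<open>\<not> x \<le> y\<close> show False by auto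
    qed
    with xy show "the (pinv \<alpha> x') \<le> the (pinv \<alpha> y')" by simp
  qed
  ultimately show ?thesis
    using assms unfolding IO_inf_def by (auto simp: d r)
qed

lemma partial_identity_in_IO_inf: "finite A \<Longrightarrow> Some |` (X - A) \<in> IO_inf X"
  unfolding IO_inf_def
  by (auto simp: dom_def ran_def restrict_map_def mono_on_def inj_on_def split: if_splits
      intro: finite_subset[of _ A])

lemma pmult_identity: "\<alpha> \<in> IO_inf X \<Longrightarrow> \<alpha> \<cdot> Some |` X = \<alpha>"
  by (rule ext) (auto simp: pmult_apply restrict_map_def dest: IO_inf_carrier split: option.split)

lemma idempotent_fixes_domain:
  assumes "\<epsilon> \<in> IO_inf X" "\<epsilon> \<cdot> \<epsilon> = \<epsilon>" "\<epsilon> x = Some y"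
  shows "y = x"
proof -
  have "\<epsilon> y = Some y" using assms(2,3) pmult_eq_Some_iff[of \<epsilon> \<epsilon> x y] by auto
  then show ?thesis using IO_inf_inj assms(1,3) by metis
qed

section \<open>Members preserve the layers\<close>

text \<open>Induction on the layer. If a point of layer \<open>i + 1\<close> went to layer \<open>i\<close> or below, then by the
  induction hypothesis and monotonicity all points of the domain that lie in layer \<open>i\<close> above a fixed
  one would be squeezed into a bounded interval of layer \<open>i\<close>; there are infinitely many of them.\<close>

lemma layer_le_image_layer:
  assumes "\<alpha> \<in> IO_lex n" "\<alpha> (i, k) = Some y"
  shows "i \<le> fst y"
  using assms(2)
proof (induction i arbitrary: k y)
  case 0
  then show ?case by simp
next
  case (Suc i)
  have \<alpha>: "\<alpha> \<in> IO_inf (layers n)" using assms(1) by (simp add: IO_lex_def)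
  have Suc_i: "Suc i \<in> {1..n}" and y: "y \<in> layers n"
    using IO_inf_carrier[OF \<alpha> Suc.prems] by auto
  \<comment> \<open>The layers are numbered from \<open>1\<close>, so below the first one there are no points to compare with.\<close>
  show ?case
  proof (cases "i = 0")
    case True
    with y show ?thesis by auto
  next
    case False
    define B where "B = {l. \<alpha> (i, l) \<noteq> None}"
    have "finite (layers n - dom \<alpha>)" using \<alpha> by (simp add: IO_inf_def)
    then have "finite (snd ` (layers n - dom \<alpha>))" by simp
    moreover have "- B \<subseteq> snd ` (layers n - dom \<alpha>)"
    proof
      fix l assume "l \<in> - B"
      then have "(i, l) \<in> layers n - dom \<alpha>" using False Suc_i by (auto simp: B_def)
      then show "l \<in> snd ` (layers n - dom \<alpha>)" by force
    qed
    ultimately have cof: "finite (- B)" by (rule rev_finite_subset)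
    have "infinite (UNIV :: int set)" by (rule infinite_UNIV_int)
    with cof have "B \<noteq> {}" by (metis Compl_empty_eq)
    then obtain l where "l \<in> B" by blast
    then obtain z where z: "\<alpha> (i, l) = Some z" by (auto simp: B_def)
    have iz: "i \<le> fst z" by (rule Suc.IH[OF z])
    have zy: "z \<le> y" by (rule IO_inf_mono[OF \<alpha> _ z Suc.prems]) (simp add: less_eq_prod_def)
    show ?thesis
    proof (rule ccontr)
      assume "\<not> Suc i \<le> fst y"
      with iz zy have fz: "fst z = i" and fy: "fst y = i" by (auto simp: less_eq_prod_def)
      define g where "g m = snd (the (\<alpha> (i, m)))" for m
      have val: "\<alpha> (i, m) = Some (i, g m) \<and> g m \<in> {snd z..snd y}" if m: "m \<in> B \<inter> {l..}" for m
      proof -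
        obtain w where w: "\<alpha> (i, m) = Some w" using m by (auto simp: B_def)
        have "z \<le> w" by (rule IO_inf_mono[OF \<alpha> _ z w]) (use m in \<open>simp add: less_eq_prod_def\<close>)
        moreover have "w \<le> y"
          by (rule IO_inf_mono[OF \<alpha> _ w Suc.prems]) (simp add: less_eq_prod_def)
        ultimately show ?thesis
          using fz fy w by (auto simp: less_eq_prod_def g_def prod_eq_iff)
      qed
      have "inj_on g (B \<inter> {l..})"
        by (rule inj_onI) (metis IO_inf_inj[OF \<alpha>] val prod.inject)
      moreover have "g ` (B \<inter> {l..}) \<subseteq> {snd z..snd y}" using val by blast
      ultimately have "finite (B \<inter> {l..})" by (meson finite_atLeastAtMost_int inj_on_finite)
      then have "finite {l..}"
        using cof by (metis finite_Un finite_subset[of "{l..}" "(B \<inter> {l..}) \<union> - B"] Compl_iff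
            IntI UnCI subsetI)
      then show False by (simp add: infinite_Ici)
    qed
  qed
qed

text \<open>The inverse cannot go down in layers either.\<close>

lemma layer_preserved:
  assumes "\<alpha> \<in> IO_lex n" "\<alpha> x = Some y"
  shows "fst y = fst x"
proof -
  have \<alpha>: "\<alpha> \<in> IO_inf (layers n)" using assms(1) by (simp add: IO_lex_def)
  have "fst x \<le> fst y"
    using layer_le_image_layer[OF assms(1), of "fst x" "snd x"] assms(2) by simp
  moreover have "fst y \<le> fst x"
    using layer_le_image_layer[of "pinv \<alpha>" n "fst y" "snd y" x]
      pinv_in_IO_inf[OF \<alpha>] pinv_eq_Some_iff[OF \<alpha>] assms(2) by (simp add: IO_lex_def)
  ultimately show ?thesis by simp
qed

section \<open>The relations \<open>\<sigma>\<close>\<close>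

text \<open>The idempotents \<open>\<epsilon>\<^sub>i\<^sup>\<circ>\<close> are partial identities with a finite part of layer \<open>i\<close> removed. All later
  work with \<open>\<sigma>\<^sub>i\<close> uses them in this form.\<close>

lemma circ_idempotent:
  assumes "\<epsilon> \<in> IO_lex n" "\<epsilon> \<cdot> \<epsilon> = \<epsilon>"
  obtains A where "finite A" "A \<subseteq> {i} \<times> UNIV" "circ n i \<epsilon> = Some |` (layers n - A)"
proof
  have \<epsilon>: "\<epsilon> \<in> IO_inf (layers n)" using assms(1) by (simp add: IO_lex_def)
  define A where "A = ({i} \<times> UNIV) \<inter> (layers n - dom \<epsilon>)"
  show "finite A" using \<epsilon> by (simp add: A_def IO_inf_def)
  show "A \<subseteq> {i} \<times> UNIV" by (simp add: A_def)
  show "circ n i \<epsilon> = Some |` (layers n - A)"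
  proof
    fix x :: "nat \<times> int"
    show "circ n i \<epsilon> x = (Some |` (layers n - A)) x"
      by (cases x; cases "\<epsilon> x")
        (auto simp: circ_def tuple_def component_def restrict_map_def A_def dom_def
          dest: idempotent_fixes_domain[OF \<epsilon> assms(2)])
  qed
qed

lemma sigmaE:
  assumes "(\<alpha>, \<beta>) \<in> sigma n i"
  obtains A where "\<alpha> \<in> IO_lex n" "\<beta> \<in> IO_lex n" "finite A" "A \<subseteq> {i} \<times> UNIV"
    "\<alpha> \<cdot> Some |` (layers n - A) = \<beta> \<cdot> Some |` (layers n - A)"
  using assms circ_idempotent[where i = i and n = n] unfolding sigma_def
  by (smt (verit) case_prodD mem_Collect_eq)

lemma equal_restriction_apply:
  assumes "\<alpha> \<in> IO_inf X" "\<alpha> \<cdot> Some |` (X - A) = \<beta> \<cdot> Some |` (X - A)"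
    and "\<alpha> x = Some y" "y \<notin> A"
  shows "\<beta> x = Some y"
proof -
  have "(\<alpha> \<cdot> Some |` (X - A)) x = Some y"
    using assms(3,4) IO_inf_carrier[OF assms(1,3)] by (simp add: pmult_apply)
  then show ?thesis
    unfolding assms(2) by (auto simp: pmult_eq_Some_iff restrict_map_def split: if_splits)
qed

text \<open>Since layers are preserved, a point outside layer \<open>i\<close> never meets the removed set \<open>A\<close>.\<close>

lemma sigma_agree_off_layer:
  assumes "(\<alpha>, \<beta>) \<in> sigma n i" "fst x \<noteq> i"
  shows "\<alpha> x = \<beta> x"
proof -
  obtain A where S: "\<alpha> \<in> IO_lex n" "\<beta> \<in> IO_lex n" and A: "A \<subseteq> {i} \<times> UNIV"
    and eq: "\<alpha> \<cdot> Some |` (layers n - A) = \<beta> \<cdot> Some |` (layers n - A)"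
    using sigmaE[OF assms(1)] by metis
  have "\<beta> x = Some y" if "\<alpha> x = Some y" for y
  proof (rule equal_restriction_apply[OF _ eq that])
    show "\<alpha> \<in> IO_inf (layers n)" using S(1) by (simp add: IO_lex_def)
    show "y \<notin> A" using layer_preserved[OF S(1) that] A assms(2) by auto
  qed
  moreover have "\<alpha> x = Some y" if "\<beta> x = Some y" for y
  proof (rule equal_restriction_apply[OF _ eq[symmetric] that])
    show "\<beta> \<in> IO_inf (layers n)" using S(2) by (simp add: IO_lex_def)
    show "y \<notin> A" using layer_preserved[OF S(2) that] A assms(2) by auto
  qed
  ultimately show ?thesis by (metis option.exhaust)
qed

text \<open>Where \<open>\<alpha>\<close> and \<open>\<beta>\<close> differ, one of them takes a value in the finite removed set, and each such
  value is taken at most once.\<close>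

lemma sigma_finite_difference:
  assumes "(\<alpha>, \<beta>) \<in> sigma n i"
  shows "finite {x. \<alpha> x \<noteq> \<beta> x}"
proof -
  obtain A where S: "\<alpha> \<in> IO_inf (layers n)" "\<beta> \<in> IO_inf (layers n)" and A: "finite A"
    and eq: "\<alpha> \<cdot> Some |` (layers n - A) = \<beta> \<cdot> Some |` (layers n - A)"
    using sigmaE[OF assms] unfolding IO_lex_def by metis
  have "{x. \<alpha> x \<noteq> \<beta> x} \<subseteq> (\<lambda>y. the (pinv \<alpha> y)) ` A \<union> (\<lambda>y. the (pinv \<beta> y)) ` A"
  proof
    fix x assume "x \<in> {x. \<alpha> x \<noteq> \<beta> x}"
    then consider y where "\<alpha> x = Some y" "\<beta> x \<noteq> Some y" | y where "\<beta> x = Some y" "\<alpha> x \<noteq> Some y"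
      by (cases "\<alpha> x"; cases "\<beta> x") (auto simp del: split_paired_All split_paired_Ex)
    then show "x \<in> (\<lambda>y. the (pinv \<alpha> y)) ` A \<union> (\<lambda>y. the (pinv \<beta> y)) ` A"
    proof cases
      case 1
      then have "y \<in> A" using equal_restriction_apply[OF S(1) eq] by blast
      moreover have "pinv \<alpha> y = Some x" using pinv_eq_Some_iff[OF S(1)] 1 by simp
      ultimately show ?thesis by force
    next
      case 2
      then have "y \<in> A" using equal_restriction_apply[OF S(2) eq[symmetric]] by blast
      moreover have "pinv \<beta> y = Some x" using pinv_eq_Some_iff[OF S(2)] 2 by simp
      ultimately show ?thesis by force
    qed
  qed
  then show ?thesis by (rule finite_subset) (simp add: A)
qed

lemma sigma_list_snoc: "is \<noteq> [] \<Longrightarrow> sigma_list n (is @ [j]) = sigma_list n is O sigma n j"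
  by (induction "is" rule: induct_list012) (simp_all add: O_assoc)

lemma sigma_list_agree_off_layers:
  "\<lbrakk>(\<alpha>, \<beta>) \<in> sigma_list n is; fst x \<notin> set is\<rbrakk> \<Longrightarrow> \<alpha> x = \<beta> x"
  by (induction n "is" arbitrary: \<alpha> rule: sigma_list.induct)
    (auto dest: sigma_agree_off_layer)

lemma sigma_list_finite_difference:
  "(\<alpha>, \<beta>) \<in> sigma_list n is \<Longrightarrow> finite {x. \<alpha> x \<noteq> \<beta> x}"
proof (induction n "is" arbitrary: \<alpha> rule: sigma_list.induct)
  case (3 n i j js)
  then obtain \<gamma> where \<gamma>: "(\<alpha>, \<gamma>) \<in> sigma n i" "(\<gamma>, \<beta>) \<in> sigma_list n (j # js)" by auto
  have "finite ({x. \<alpha> x \<noteq> \<gamma> x} \<union> {x. \<gamma> x \<noteq> \<beta> x})"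
    using sigma_finite_difference[OF \<gamma>(1)] "3.IH"[OF \<gamma>(2)] by simp
  then show ?case by (rule rev_finite_subset) auto
qed (auto dest: sigma_finite_difference)

section \<open>Congruences separating a point of a layer\<close>

text \<open>\<open>spread\<close> sends the point \<open>(j, l)\<close> to \<open>(j, k)\<close> and for \<open>N > 0\<close> opens the gap
  \<open>k - N < y < k + N\<close> in every layer, with \<open>(j, k)\<close> as the only image point inside the gaps.\<close>

definition spread :: "nat \<Rightarrow> nat \<Rightarrow> int \<Rightarrow> int \<Rightarrow> int \<Rightarrow> (nat \<times> int \<rightharpoonup> nat \<times> int)" where
  "spread n j l k N = (\<lambda>(i, x). if i \<in> {1..n}
     then Some (i, if i = j \<and> x = l then k else if x < l then x - l + k - N else x - l + k + N)
     else None)"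

lemma spread_in_IO_lex:
  assumes "N \<ge> 0"
  shows "spread n j l k N \<in> IO_lex n"
proof -
  let ?\<delta> = "spread n j l k N"
  have d: "dom ?\<delta> = layers n" by (auto simp: spread_def dom_def split: if_splits)
  have "layers n - ran ?\<delta> \<subseteq> {1..n} \<times> {k - N..k + N}"
  proof (rule subrelI)
    fix i y assume "(i, y) \<in> layers n - ran ?\<delta>"
    then have iy: "i \<in> {1..n}" "(i, y) \<notin> ran ?\<delta>" by auto
    have "?\<delta> (i, y + l - k + N) = Some (i, y)" if "y < k - N"
      using iy(1) that assms by (simp add: spread_def)
    moreover have "?\<delta> (i, y + l - k - N) = Some (i, y)" if "y > k + N"
      using iy(1) that assms by (simp add: spread_def)
    ultimately have "\<not> y < k - N" "\<not> y > k + N" using iy(2) by (blast intro: ranI)+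
    then show "(i, y) \<in> {1..n} \<times> {k - N..k + N}" using iy(1) by simp
  qed
  then have "finite (layers n - ran ?\<delta>)" by (rule finite_subset) simp
  moreover have "ran ?\<delta> \<subseteq> layers n" by (auto simp: spread_def ran_def split: if_splits)
  moreover have "inj_on ?\<delta> (dom ?\<delta>)"
    using assms by (auto simp: inj_on_def spread_def split: if_splits)
  moreover have "mono_on (dom ?\<delta>) (\<lambda>x. the (?\<delta> x))"
    unfolding d using assms by (auto simp: mono_on_def spread_def less_eq_prod_def)
  ultimately show ?thesis unfolding IO_lex_def IO_inf_def using d by simp
qed

text \<open>The removed point \<open>(j, l)\<close> is arbitrary in the layer of the given point \<open>(j, k)\<close>, because
  \<open>spread\<close> can move one to the other.\<close>

lemma congruence_removes_point:
  assumes C: "semigroup_congruence (IO_lex n) C" and \<alpha>\<beta>: "(\<alpha>, \<beta>) \<in> C"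
    and fin: "finite {x. \<alpha> x \<noteq> \<beta> x}" and p: "\<alpha> (j, k) \<noteq> None" "\<beta> (j, k) = None"
  shows "(Some |` layers n, Some |` (layers n - {(j, l)})) \<in> C"
proof -
  have S: "\<alpha> \<in> IO_lex n"
    using C \<alpha>\<beta> unfolding semigroup_congruence_def equiv_def refl_on_def by blast
  have j: "j \<in> {1..n}" using p(1) IO_inf_carrier[of \<alpha> "layers n"] S by (auto simp: IO_lex_def)
  \<comment> \<open>The points that the left factor must avoid, apart from \<open>(j, k)\<close> itself.\<close>
  define F where "F = (layers n - dom \<alpha>) \<union> {x. \<alpha> x \<noteq> \<beta> x}"
  have "finite F" using S fin by (simp add: F_def IO_lex_def IO_inf_def)
  \<comment> \<open>Adjoining \<open>0\<close> keeps the maximum meaningful when \<open>F\<close> is empty, and \<open>N\<close> nonnegative.\<close>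
  define N where "N = Max (insert 0 ((\<lambda>x. \<bar>snd x - k\<bar>) ` F)) + 1"
  have N: "\<bar>x - k\<bar> < N" if "(i, x) \<in> F" for i x
  proof -
    have "\<bar>x - k\<bar> \<le> Max (insert 0 ((\<lambda>x. \<bar>snd x - k\<bar>) ` F))"
      by (rule Max_ge) (use that \<open>finite F\<close> in force)+
    then show ?thesis by (simp add: N_def)
  qed
  have N0: "N \<ge> 0" 
    unfolding N_def using \<open>finite F\<close> by (smt (verit) Max_ge finite_imageI finite_insert insertI1)
  define \<delta> where "\<delta> = spread n j l k N"
  have \<delta>S: "\<delta> \<in> IO_lex n" unfolding \<delta>_def by (rule spread_in_IO_lex[OF N0])
  have \<delta>p: "\<delta> (j, l) = Some (j, k)" using j by (simp add: \<delta>_def spread_def)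
  have avoid: "\<exists>y. \<delta> x = Some y \<and> y \<notin> F" if "x \<in> layers n" "x \<noteq> (j, l)" for x
  proof -
    obtain i m where [simp]: "x = (i, m)" by (cases x)
    show ?thesis using that N[of i "m - l + k - N"] N[of i "m - l + k + N"] N0
      by (auto simp: \<delta>_def spread_def)
  qed
  define \<alpha>' \<beta>' where "\<alpha>' = \<delta> \<cdot> \<alpha>" and "\<beta>' = \<delta> \<cdot> \<beta>"
  have \<alpha>\<beta>': "(\<alpha>', \<beta>') \<in> C"
    using C \<alpha>\<beta> \<delta>S unfolding semigroup_congruence_def \<alpha>'_def \<beta>'_def by blast
  then have S': "\<alpha>' \<in> IO_inf (layers n)"
    using C unfolding semigroup_congruence_def equiv_def refl_on_def IO_lex_def by blast
  have total: "\<alpha>' x \<noteq> None" if "x \<in> layers n" for x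
  proof (cases "x = (j, l)")
    case True
    then show ?thesis using p(1) by (simp add: \<alpha>'_def pmult_apply \<delta>p)
  next
    case False
    with avoid[OF that] obtain y where y: "\<delta> x = Some y" "y \<notin> F" by blast
    then have "y \<in> layers n" using IO_inf_carrier[of \<delta> "layers n"] \<delta>S by (simp add: IO_lex_def)
    with y have "y \<in> dom \<alpha>" by (auto simp: F_def)
    with y show ?thesis by (auto simp: \<alpha>'_def pmult_apply)
  qed
  have undef: "\<beta>' (j, l) = None" by (simp add: \<beta>'_def pmult_apply \<delta>p p(2))
  have agree: "\<beta>' x = \<alpha>' x" if "x \<in> layers n" "x \<noteq> (j, l)" for x
    using avoid[OF that] by (auto simp: \<alpha>'_def \<beta>'_def pmult_apply F_def)
  have out: "\<alpha>' x = None" "\<beta>' x = None" if "x \<notin> layers n" for x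
    using that by (auto simp: \<alpha>'_def \<beta>'_def pmult_apply \<delta>_def spread_def split: prod.splits)
  have inv: "pinv \<alpha>' y = Some x" if "\<alpha>' x = Some y" for x y
    using that pinv_eq_Some_iff[OF S'] by simp
  have "\<alpha>' \<cdot> pinv \<alpha>' = Some |` layers n"
  proof
    fix x show "(\<alpha>' \<cdot> pinv \<alpha>') x = (Some |` layers n) x"
      using total[of x] out[of x] inv[of x]
      by (cases "x \<in> layers n") (auto simp: pmult_apply restrict_map_def simp del: mem_Sigma_iff)
  qed
  moreover have "\<beta>' \<cdot> pinv \<alpha>' = Some |` (layers n - {(j, l)})"
  proof
    fix x show "(\<beta>' \<cdot> pinv \<alpha>') x = (Some |` (layers n - {(j, l)})) x"
      using total[of x] out[of x] inv[of x] agree[of x] undef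
      by (cases "x \<in> layers n"; cases "x = (j, l)")
        (auto simp: pmult_apply restrict_map_def simp del: mem_Sigma_iff)
  qed
  moreover have "pinv \<alpha>' \<in> IO_lex n" using pinv_in_IO_inf[OF S'] by (simp add: IO_lex_def)
  ultimately show ?thesis
    using C \<alpha>\<beta>' unfolding semigroup_congruence_def by (metis (no_types, lifting) case_prodD)
qed

text \<open>Writing \<open>E\<close> for a partial identity missing a finite part of layer \<open>j\<close>, it suffices that \<open>C\<close> relates
  the identity to \<open>E\<close>: if \<open>\<phi> \<cdot> E = \<psi> \<cdot> E\<close>, then \<open>C\<close> relates \<open>\<phi>\<close> to \<open>\<phi> \<cdot> E = \<psi> \<cdot> E\<close>, and this to \<open>\<psi>\<close>.\<close>

lemma sigma_subset_congruence:
  assumes C: "semigroup_congruence (IO_lex n) C" and \<alpha>\<beta>: "(\<alpha>, \<beta>) \<in> C"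
    and fin: "finite {x. \<alpha> x \<noteq> \<beta> x}" and p: "\<alpha> (j, k) \<noteq> \<beta> (j, k)"
  shows "sigma n j \<subseteq> C"
proof -
  have sym: "(\<psi>, \<phi>) \<in> C" if "(\<phi>, \<psi>) \<in> C" for \<phi> \<psi>
    using C that unfolding semigroup_congruence_def equiv_def by (blast dest: symD)
  have trans: "(\<phi>, \<chi>) \<in> C" if "(\<phi>, \<psi>) \<in> C" "(\<psi>, \<chi>) \<in> C" for \<phi> \<psi> \<chi>
    using C that unfolding semigroup_congruence_def equiv_def by (blast dest: transD)
  have left: "(\<gamma> \<cdot> \<phi>, \<gamma> \<cdot> \<psi>) \<in> C" and right: "(\<phi> \<cdot> \<gamma>, \<psi> \<cdot> \<gamma>) \<in> C"
    if "(\<phi>, \<psi>) \<in> C" "\<gamma> \<in> IO_lex n" for \<phi> \<psi> \<gamma>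
    using C that unfolding semigroup_congruence_def by blast+
  have E: "Some |` (layers n - A) \<in> IO_lex n" if "finite A" for A
    using partial_identity_in_IO_inf[OF that] by (simp add: IO_lex_def)
  have point: "(Some |` layers n, Some |` (layers n - {(j, l)})) \<in> C" for l
  proof (cases "\<alpha> (j, k)")
    case None
    have "finite {x. \<beta> x \<noteq> \<alpha> x}" using fin by (simp add: eq_commute)
    with None p show ?thesis
      using congruence_removes_point[OF C sym[OF \<alpha>\<beta>], of j k l] by simp
  next
    case (Some a)
    show ?thesis
    proof (cases "\<beta> (j, k)")
      case None
      with Some show ?thesis using congruence_removes_point[OF C \<alpha>\<beta> fin, of j k l] by simp
    next
      case (Some b)
      \<comment> \<open>Deleting the value \<open>b\<close> makes the second map undefined here, but not the first.\<close>
      let ?e = "Some |` (layers n - {b})"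
      have "\<alpha> \<in> IO_lex n"
        using C \<alpha>\<beta> unfolding semigroup_congruence_def equiv_def refl_on_def by blast
      then have "a \<in> layers n"
        using \<open>\<alpha> (j, k) = Some a\<close> IO_inf_carrier[of \<alpha> "layers n"] by (simp add: IO_lex_def)
      then have "(\<alpha> \<cdot> ?e) (j, k) \<noteq> None"
        using \<open>\<alpha> (j, k) = Some a\<close> Some p by (simp add: pmult_apply)
      moreover have "(\<beta> \<cdot> ?e) (j, k) = None" using Some by (simp add: pmult_apply)
      moreover have "finite {x. (\<alpha> \<cdot> ?e) x \<noteq> (\<beta> \<cdot> ?e) x}"
        using fin by (rule rev_finite_subset) (auto simp: pmult_apply)
      moreover have "(\<alpha> \<cdot> ?e, \<beta> \<cdot> ?e) \<in> C" using right[OF \<alpha>\<beta> E] by simp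
      ultimately show ?thesis using congruence_removes_point[OF C] by blast
    qed
  qed
  have removes: "(Some |` layers n, Some |` (layers n - A)) \<in> C"
    if "finite A" "A \<subseteq> {j} \<times> UNIV" for A
    using that
  proof (induction A rule: finite_induct)
    case empty
    then show ?case using E[of "{}"] C
      unfolding semigroup_congruence_def equiv_def by (auto dest: refl_onD)
  next
    case (insert q A)
    then obtain l where q: "q = (j, l)" by auto
    have "(Some |` (layers n - A)) = Some |` layers n \<cdot> Some |` (layers n - A)"
      and "Some |` (layers n - insert q A) = Some |` (layers n - {q}) \<cdot> Some |` (layers n - A)"
      by (auto simp: fun_eq_iff pmult_apply restrict_map_def)
    then have "(Some |` (layers n - A), Some |` (layers n - insert q A)) \<in> C"
      using right[OF point[of l] E[OF insert.hyps(1)]] by (simp add: q)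
    with insert show ?case using trans by blast
  qed
  show ?thesis
  proof clarify
    fix \<phi> \<psi> assume "(\<phi>, \<psi>) \<in> sigma n j"
    then obtain A where S: "\<phi> \<in> IO_lex n" "\<psi> \<in> IO_lex n" and A: "finite A" "A \<subseteq> {j} \<times> UNIV"
      and eq: "\<phi> \<cdot> Some |` (layers n - A) = \<psi> \<cdot> Some |` (layers n - A)"
      using sigmaE by metis
    have "(\<chi>, \<chi> \<cdot> Some |` (layers n - A)) \<in> C" if "\<chi> \<in> IO_lex n" for \<chi>
      using left[OF removes[OF A] that] pmult_identity[of \<chi> "layers n"] that
      by (simp add: IO_lex_def)
    then show "(\<phi>, \<psi>) \<in> C" using S eq trans sym by metis
  qed
qed

theorem theorem6:
  fixes n :: nat
    and C :: "((nat \<times> int \<rightharpoonup> nat \<times> int) \<times> (nat \<times> int \<rightharpoonup> nat \<times> int)) set"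
  assumes "n \<ge> 1"
    and "semigroup_congruence (IO_lex n) C"
  shows "(\<forall>i\<in>{1..n}. Id_on (IO_lex n) \<subseteq> C \<and> C \<subseteq> sigma n i \<longrightarrow>
            C = Id_on (IO_lex n) \<or> C = sigma n i) \<and>
         (\<forall>is j. is \<noteq> [] \<and> distinct (is @ [j]) \<and> set (is @ [j]) \<subseteq> {1..n} \<and>
            sigma_list n is \<subseteq> C \<and> C \<subseteq> sigma_list n (is @ [j]) \<longrightarrow>
            C = sigma_list n is \<or> C = sigma_list n (is @ [j]))"
proof (intro conjI ballI allI impI)
  fix i assume i: "Id_on (IO_lex n) \<subseteq> C \<and> C \<subseteq> sigma n i"
  show "C = Id_on (IO_lex n) \<or> C = sigma n i"
  proof (rule disjCI)
    assume "C \<noteq> sigma n i"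
    have "\<alpha> = \<beta>" if "(\<alpha>, \<beta>) \<in> C" for \<alpha> \<beta>
    proof
      fix x
      show "\<alpha> x = \<beta> x"
      proof (cases "fst x = i")
        case True
        have "\<not> sigma n i \<subseteq> C" using i \<open>C \<noteq> sigma n i\<close> by blast
        then show ?thesis
          using sigma_subset_congruence[OF assms(2) that, of "fst x" "snd x"]
            sigma_finite_difference that i True by auto
      next
        case False
        then show ?thesis using sigma_agree_off_layer that i by blast
      qed
    qed
    moreover have "C \<subseteq> IO_lex n \<times> IO_lex n"
      using assms(2) unfolding semigroup_congruence_def equiv_def refl_on_def by blast
    ultimately show "C = Id_on (IO_lex n)" using i by fast
  qed
next
  fix "is" j
  assume h: "is \<noteq> [] \<and> distinct (is @ [j]) \<and> set (is @ [j]) \<subseteq> {1..n} \<and>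
    sigma_list n is \<subseteq> C \<and> C \<subseteq> sigma_list n (is @ [j])"
  then have snoc: "sigma_list n (is @ [j]) = sigma_list n is O sigma n j"
    by (simp add: sigma_list_snoc)
  show "C = sigma_list n is \<or> C = sigma_list n (is @ [j])"
  proof (cases "sigma n j \<subseteq> C")
    case True
    have "sigma_list n is O sigma n j \<subseteq> C O C" using h True by (intro relcomp_mono) auto
    also have "C O C \<subseteq> C"
      using assms(2) unfolding semigroup_congruence_def equiv_def by (auto dest: transD)
    finally show ?thesis using h snoc by auto
  next
    case False
    have "C \<subseteq> sigma_list n is"
    proof clarify
      fix \<alpha> \<beta> assume C: "(\<alpha>, \<beta>) \<in> C"
      then have "(\<alpha>, \<beta>) \<in> sigma_list n (is @ [j])" using h by blast
      then have fin: "finite {x. \<alpha> x \<noteq> \<beta> x}" by (rule sigma_list_finite_difference)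
      obtain \<gamma> where \<gamma>: "(\<alpha>, \<gamma>) \<in> sigma_list n is" "(\<gamma>, \<beta>) \<in> sigma n j"
        using \<open>(\<alpha>, \<beta>) \<in> sigma_list n (is @ [j])\<close> snoc by auto
      have "\<gamma> = \<beta>"
      proof
        fix x
        show "\<gamma> x = \<beta> x"
        proof (cases "fst x = j")
          case True
          then have "\<alpha> x = \<gamma> x" using sigma_list_agree_off_layers[OF \<gamma>(1)] h by auto
          moreover have "\<alpha> x = \<beta> x"
            using sigma_subset_congruence[OF assms(2) C fin, of "fst x" "snd x"] False True by auto
          ultimately show ?thesis by simp
        next
          case False
          then show ?thesis using sigma_agree_off_layer[OF \<gamma>(2)] by simp
        qed
      qed
      with \<gamma>(1) show "(\<alpha>, \<beta>) \<in> sigma_list n is" by simp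
    qed
    with h show ?thesis by blast
  qed
qed

end
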